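(* Let $n\ge 2$ be an integer. For every $\underline{p}=(a_1,\ldots,a_n,b_1,\ldots,b_n,c_2,\ldots,c_n)\in\mathbb{Z}^{3n-1}$ one has the equality (in $(0,+\infty]$) $$J(\underline{p})=K(\underline{P}),$$ where $\underline{P}=(A_1,\ldots,A_n,B_1,\ldots,B_n,C_2,\ldots,C_n)\in\mathbb{Z}^{3n-1}$ is given in terms of $\underline{p}$ by: - $A_k=a_{n+1-k}$ for $1\le k\le n$; - $B_k=b_{n+1-k}$ for $2\le k\le n$, and $B_1=a_{n-1}+b_n-c_2-c_3-\cdots-c_n$; - $C_k=a_{n+1-k}+b_{n+1-k}-c_k-c_{k+1}-\cdots-c_n$ for every even $k\in\{2,\ldots,n\}$; - $C_k=c_k+c_{k+1}+\cdots+c_n-a_{n-k}$ for every odd $k\in\{3,\ldots,n\}$, with the convention $a_0=0$.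
   Context: For $\underline{x}=(x_1,\ldots,x_n)\in[0,1]^n$ and $k\in\{0,\ldots,n\}$ put $$D_k(\underline{x})=\sum_{j=0}^{k}(-1)^j x_nx_{n-1}\cdots x_{n-j+1}$$ (the $j=0$ term is $1$), so that $D_0=1$, $D_1=1-x_n$, $D_2=1-x_n(1-x_{n-1})$, etc. For $\underline{p}=(a_1,\ldots,a_n,b_1,\ldots,b_n,c_2,\ldots,c_n)\in\mathbb{Z}^{3n-1}$ define the (possibly infinite) integral $$J(\underline{p})=\int_{[0,1]^n}\frac{\prod_{k=1}^n x_k^{a_k}(1-x_k)^{b_k}}{\prod_{k=2}^n D_k(\underline{x})^{c_k}}\cdot\frac{\prod_{k\in\{2,\ldots,n-2\},\ k\text{ even}}D_k(\underline{x})}{\prod_{k\in\{3,\ldots,n-1\},\ k\text{ odd}}D_k(\underline{x})}\cdot\frac{dx_1\cdots dx_n}{D_n(\underline{x})}.$$ For $\underline{P}=(A_1,\ldots,A_n,B_1,\ldots,B_n,C_2,\ldots,C_n)\in\mathbb{Z}^{3n-1}$ define the (possibly infinite) integral $$K(\underline{P})=\int_{[0,1]^n}\frac{\prod_{k=1}^n y_k^{A_k}(1-y_k)^{B_k}}{\prod_{k=2}^n(1-y_1y_2\cdots y_k)^{C_k+1}}\,dy_1\cdots dy_n.$$ Empty products are equal to $1$. Both integrands are positive on the open cube, so the integrals are well defined in $(0,+\infty]$. *)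

theory Defs
  imports "HOL-Analysis.Analysis"
begin

text \<open>
  A point of the n-cube is a function on the index set \<open>{1..n}\<close>, a parameter tuple is given by
  functions \<open>nat \<Rightarrow> int\<close>, of which only the entries with index in \<open>{1..n}\<close> (for a and b) or
  \<open>{2..n}\<close> (for c) are used.
\<close>

definition cube :: "nat \<Rightarrow> (nat \<Rightarrow> real) set" where
  "cube n = (\<Pi>\<^sub>E i\<in>{1..n}. {0..1})"

definition lebesgue_n :: "nat \<Rightarrow> (nat \<Rightarrow> real) measure" where
  "lebesgue_n n = (\<Pi>\<^sub>M i\<in>{1..n}. lborel)"

definition D :: "nat \<Rightarrow> nat \<Rightarrow> (nat \<Rightarrow> real) \<Rightarrow> real" where
  "D n k x = (\<Sum>j=0..k. (-1) ^ j * (\<Prod>i\<in>{n+1-j..n}. x i))"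

text \<open>
  The integrals take values in \<^typ>\<open>ennreal\<close>. On the boundary of the cube, a null set, the
  integrands may involve the conventional values \<open>0 powi m = 0\<close> for \<open>m < 0\<close> and \<open>r / 0 = 0\<close>;
  this does not affect the integrals.
\<close>

definition J :: "nat \<Rightarrow> (nat \<Rightarrow> int) \<Rightarrow> (nat \<Rightarrow> int) \<Rightarrow> (nat \<Rightarrow> int) \<Rightarrow> ennreal" where
  "J n a b c =
    (\<integral>\<^sup>+ x \<in> cube n. ennreal (
        (\<Prod>k=1..n. x k powi a k * (1 - x k) powi b k) / (\<Prod>k=2..n. D n k x powi c k)
      * ((\<Prod>k\<in>{k\<in>{2..n-2}. even k}. D n k x) / (\<Prod>k\<in>{k\<in>{3..n-1}. odd k}. D n k x))
      * (1 / D n n x)) \<partial>lebesgue_n n)"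

definition K :: "nat \<Rightarrow> (nat \<Rightarrow> int) \<Rightarrow> (nat \<Rightarrow> int) \<Rightarrow> (nat \<Rightarrow> int) \<Rightarrow> ennreal" where
  "K n A B C =
    (\<integral>\<^sup>+ y \<in> cube n. ennreal (
        (\<Prod>k=1..n. y k powi A k * (1 - y k) powi B k)
      / (\<Prod>k=2..n. (1 - (\<Prod>i=1..k. y i)) powi (C k + 1))) \<partial>lebesgue_n n)"

end

theory Submission
  imports Defs
begin

text \<open>
  Put \<open>z\<^sub>k = x\<^bsub>n+1-k\<^esub>\<close>. Then \<open>D\<^sub>k = (1 - z\<^sub>k) D\<^bsub>k-1\<^esub> + z\<^sub>k D\<^bsub>k-2\<^esub>\<close>, and the two integrals are
  related by the triangular substitution \<open>y\<^sub>k = z\<^sub>k\<close> for odd \<open>k\<close> and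
  \<open>y\<^sub>k = z\<^sub>k D\<^bsub>k-2\<^esub> / D\<^sub>k\<close> for even \<open>k\<close>. In the variable \<open>z\<^sub>k\<close> alone it is a Moebius
  transformation of the unit interval fixing both endpoints, so one-dimensional substitutions suffice.
  It satisfies \<open>1 - y\<^sub>1 \<dots> y\<^sub>k = D\<^bsub>k-1\<^esub> / D\<^sub>k\<close> for even \<open>k\<close> and
  \<open>D\<^sub>k / D\<^bsub>k-1\<^esub>\<close> for odd \<open>k\<close>, with Jacobian the product of
  \<open>D\<^bsub>k-1\<^esub> D\<^bsub>k-2\<^esub> / D\<^sub>k\<^sup>2\<close> over even \<open>k\<close>. Comparing exponents gives the parameter change.
\<close>

section \<open>The Moebius substitution in one variable\<close>

lemma borel_measurable_powi [measurable (raw)]: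
  fixes f :: "'a \<Rightarrow> real"
  assumes [measurable]: "f \<in> borel_measurable M"
  shows "(\<lambda>x. f x powi k) \<in> borel_measurable M"
  unfolding power_int_def by measurable

text \<open>With \<open>p\<close> = D_(k-1) and \<open>q\<close> = D_(k-2) the recursion for D turns
  the denominator at t = z_k into D_k, so the value is z_k D_(k-2) / D_k. With
  \<open>p = q = 1\<close> it is the identity, which covers the odd indices.\<close>

definition moeb :: "real \<Rightarrow> real \<Rightarrow> real \<Rightarrow> real" where
  "moeb p q t = t * q / ((1 - t) * p + t * q)"

definition moeb_deriv :: "real \<Rightarrow> real \<Rightarrow> real \<Rightarrow> real" where
  "moeb_deriv p q t = p * q / ((1 - t) * p + t * q)\<^sup>2"

lemma borel_measurable_moeb [measurable (raw)]:
  assumes [measurable]: "f \<in> borel_measurable M" "g \<in> borel_measurable M" "h \<in> borel_measurable M"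
  shows "(\<lambda>x. moeb (f x) (g x) (h x)) \<in> borel_measurable M"
    and "(\<lambda>x. moeb_deriv (f x) (g x) (h x)) \<in> borel_measurable M"
  unfolding moeb_def moeb_deriv_def by measurable

lemma moeb_deriv_nonneg: "0 \<le> p \<Longrightarrow> 0 \<le> q \<Longrightarrow> 0 \<le> moeb_deriv p q t"
  by (simp add: moeb_deriv_def)

lemma moeb_denominator_pos:
  assumes "0 < p" "0 < q" "0 \<le> t" "t \<le> 1"
  shows "0 < (1 - t) * p + t * (q::real)"
proof (cases "t = 0")
  case False
  then have "0 < t * q" using assms by simp
  then show ?thesis using assms by (simp add: add_nonneg_pos)
qed (use assms in simp)

text \<open>For positive \<open>p\<close> and \<open>q\<close> the map \<open>moeb p q\<close> has a
  continuous nonnegative derivative on the unit interval and fixes both endpoints, so ordinary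
  substitution applies. The two endpoints form a null set. They are dropped on the right because
  later weights are known to be positive only when the earlier coordinates lie strictly inside the
  interval: D_1 = 1 - x_n vanishes at x_n = 1.\<close>

lemma nn_integral_moeb:
  fixes f :: "real \<Rightarrow> ennreal"
  assumes [measurable]: "f \<in> borel_measurable borel" and "0 < p" "0 < q"
  shows "(\<integral>\<^sup>+t. f t * indicator {0..1} t \<partial>lborel) =
    (\<integral>\<^sup>+t. f (moeb p q t) * ennreal (moeb_deriv p q t) * indicator {0<..<1} t \<partial>lborel)"
proof -
  have pos: "0 < (1 - t) * p + t * q" if "t \<in> {0..1}" for t
    using moeb_denominator_pos assms that by simp
  have "(\<integral>\<^sup>+t. f t * indicator {0..1} t \<partial>lborel)
      = (\<integral>\<^sup>+t. f t * indicator {moeb p q 0..moeb p q 1} t \<partial>lborel)"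
    using assms by (simp add: moeb_def)
  also have "\<dots> = (\<integral>\<^sup>+t. f (moeb p q t) * ennreal (moeb_deriv p q t) * indicator {0..1} t \<partial>lborel)"
  proof (rule nn_integral_substitution_aux)
    fix t :: real assume t: "t \<in> {0..1}"
    have "((\<lambda>t. (1 - t) * p + t * q) has_real_derivative q - p) (at t)"
      "((\<lambda>t. t * q) has_real_derivative q) (at t)"
      by (auto intro!: derivative_eq_intros)
    from DERIV_divide[OF this(2,1)] pos[OF t]
    have "(moeb p q has_real_derivative
        (q * ((1 - t) * p + t * q) - t * q * (q - p)) / (((1 - t) * p + t * q) * ((1 - t) * p + t * q))) (at t)"
      unfolding moeb_def [abs_def] by simp
    moreover have "q * ((1 - t) * p + t * q) - t * q * (q - p) = p * q"
      by (simp add: algebra_simps)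
    ultimately show "(moeb p q has_real_derivative moeb_deriv p q t) (at t)"
      by (simp add: moeb_deriv_def power2_eq_square)
    show "moeb_deriv p q t \<ge> 0"
      using assms by (simp add: moeb_deriv_def)
  next
    show "continuous_on {0..1} (moeb_deriv p q)"
      unfolding moeb_deriv_def [abs_def]
    proof (intro continuous_intros ballI)
      fix t :: real assume "t \<in> {0..1}"
      from pos[OF this] show "((1 - t) * p + t * q)\<^sup>2 \<noteq> 0"
        unfolding power_eq_0_iff by simp
    qed
  qed (use assms in auto)
  also have "\<dots> = (\<integral>\<^sup>+t. f (moeb p q t) * ennreal (moeb_deriv p q t) * indicator {0<..<1} t \<partial>lborel)"
  proof (rule nn_integral_cong_AE)
    show "AE t in lborel. f (moeb p q t) * ennreal (moeb_deriv p q t) * indicator {0..1} t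
        = f (moeb p q t) * ennreal (moeb_deriv p q t) * indicator {0<..<1} t"
      using AE_lborel_singleton[of 0] AE_lborel_singleton[of 1]
      by eventually_elim (auto simp: indicator_def less_le)
  qed
  finally show ?thesis .
qed

section \<open>Triangular substitutions on the cube\<close>

text \<open>\<open>Pi\<close> does not impose extensionality, so it need not be a subset of the
  space of the product measure. Its indicator is therefore treated as a finite product of coordinate
  indicators.\<close>

lemma borel_measurable_indicator_Pi:
  assumes "finite I" "B \<in> sets borel"
  shows "(indicator (Pi I (\<lambda>_. B)) :: _ \<Rightarrow> ennreal) \<in> borel_measurable (\<Pi>\<^sub>M i\<in>I. (lborel :: real measure))"
    (is "?f \<in> borel_measurable ?M")
proof -
  have "?f = (\<lambda>x. \<Prod>i\<in>I. indicator B (x i))"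
    using assms(1) by (auto simp: fun_eq_iff indicator_def Pi_iff)
  also have "\<dots> \<in> borel_measurable ?M"
  proof (rule borel_measurable_prod_ennreal)
    fix i assume "i \<in> I"
    then have "(\<lambda>x. x i) \<in> measurable ?M borel"
      using measurable_component_singleton[of i I "\<lambda>_. lborel"] by simp
    then show "(\<lambda>x. indicator B (x i)) \<in> borel_measurable ?M"
      using assms(2) by (intro measurable_compose[OF _ borel_measurable_indicator])
  qed
  finally show ?thesis .
qed

text \<open>The update leaves the coordinates in \<open>I\<close> alone, so the condition on the new
  coordinate separates from the others and can be integrated first.\<close>

lemma indicator_Pi_insert_upd:
  assumes "i \<notin> I"
  shows "(indicator (Pi (insert i I) (\<lambda>_. B)) (x(i := t)) :: ennreal)
    = (if x \<in> Pi I (\<lambda>_. B) then indicator B t else 0)"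
proof -
  have "x(i := t) \<in> Pi (insert i I) (\<lambda>_. B) \<longleftrightarrow> x \<in> Pi I (\<lambda>_. B) \<and> t \<in> B"
    using assms by (auto simp: Pi_iff)
  then show ?thesis by (simp add: indicator_def)
qed

lemma nn_integral_triangular_moeb:
  fixes p q :: "nat \<Rightarrow> (nat \<Rightarrow> real) \<Rightarrow> real" and \<sigma> :: "nat \<Rightarrow> nat" and F :: "(nat \<Rightarrow> real) \<Rightarrow> ennreal"
  assumes inj: "inj_on \<sigma> {1..n}"
    and meas: "\<And>k m. k \<in> {1..m} \<Longrightarrow> m \<le> n \<Longrightarrow>
      p k \<in> borel_measurable (\<Pi>\<^sub>M i\<in>\<sigma> ` {1..m}. lborel) \<and>
      q k \<in> borel_measurable (\<Pi>\<^sub>M i\<in>\<sigma> ` {1..m}. lborel)"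
    and dep: "\<And>k x y. k \<in> {1..n} \<Longrightarrow> (\<And>i. i \<in> {1..<k} \<Longrightarrow> x (\<sigma> i) = y (\<sigma> i)) \<Longrightarrow>
      p k x = p k y \<and> q k x = q k y"
    and pos: "\<And>k x. k \<in> {1..n} \<Longrightarrow> (\<And>i. i \<in> {1..<k} \<Longrightarrow> x (\<sigma> i) \<in> {0<..<1}) \<Longrightarrow>
      0 < p k x \<and> 0 < q k x"
    and "F \<in> borel_measurable (\<Pi>\<^sub>M i\<in>{1..n}. lborel)"
  shows "(\<integral>\<^sup>+y. F y * indicator (Pi {1..n} (\<lambda>_. {0..1})) y \<partial>(\<Pi>\<^sub>M i\<in>{1..n}. lborel)) =
    (\<integral>\<^sup>+x. F (\<lambda>k\<in>{1..n}. moeb (p k x) (q k x) (x (\<sigma> k)))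
        * ennreal (\<Prod>k=1..n. moeb_deriv (p k x) (q k x) (x (\<sigma> k)))
        * indicator (Pi (\<sigma> ` {1..n}) (\<lambda>_. {0<..<1})) x \<partial>(\<Pi>\<^sub>M i\<in>\<sigma> ` {1..n}. lborel))"
proof -
  interpret P: product_sigma_finite "\<lambda>_::nat. lborel :: real measure" ..
  define \<phi> where "\<phi> m x = (\<lambda>k\<in>{1..m}. moeb (p k x) (q k x) (x (\<sigma> k)))" for m x
  define \<delta> where "\<delta> m x = (\<Prod>k=1..m. moeb_deriv (p k x) (q k x) (x (\<sigma> k)))" for m x
  have "(\<integral>\<^sup>+y. F y * indicator (Pi {1..m} (\<lambda>_. {0..1})) y \<partial>(\<Pi>\<^sub>M i\<in>{1..m}. lborel)) =
    (\<integral>\<^sup>+x. F (\<phi> m x) * ennreal (\<delta> m x) * indicator (Pi (\<sigma> ` {1..m}) (\<lambda>_. {0<..<1})) x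
       \<partial>(\<Pi>\<^sub>M i\<in>\<sigma> ` {1..m}. lborel))"
    if "m \<le> n" "F \<in> borel_measurable (\<Pi>\<^sub>M i\<in>{1..m}. lborel)" for m F
    using that
  \<comment> \<open>\<open>F\<close> must vary: the induction hypothesis is applied to
    \<open>G\<close>, obtained from \<open>F\<close> by integrating out the last coordinate.\<close>
  proof (induction m arbitrary: F)
    case 0
    show ?case
      by (simp add: PiM_empty nn_integral_count_space_finite \<phi>_def \<delta>_def restrict_def)
  next
    case (Suc m)
    let ?k = "Suc m" and ?s = "\<sigma> (Suc m)" and ?I = "\<sigma> ` {1..m}"
    have sets: "{1..?k} = insert ?k {1..m}" "\<sigma> ` {1..?k} = insert ?s ?I"
      by (simp_all add: atLeastAtMostSuc_conv del: image_Suc_atLeastAtMost)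
    have notin: "?s \<notin> ?I"
    proof
      assume "?s \<in> ?I"
      then obtain k where k: "k \<in> {1..m}" "\<sigma> k = ?s"
        by (metis imageE)
      then have "k = ?k"
        by (intro inj_onD[OF inj k(2)]) (use Suc.prems(1) in simp_all)
      then show False using k(1) by simp
    qed
    have s_meas: "(\<lambda>x. x (\<sigma> k)) \<in> borel_measurable (\<Pi>\<^sub>M i\<in>insert ?s ?I. lborel)"
      if "k \<in> {1..?k}" for k
    proof -
      have "\<sigma> k \<in> insert ?s ?I"
        using imageI[OF that, of \<sigma>] unfolding sets(2) .
      from measurable_component_singleton[OF this, of "\<lambda>_. lborel"] show ?thesis
        unfolding measurable_lborel1 .
    qed
    have pq_meas: "p k \<in> borel_measurable (\<Pi>\<^sub>M i\<in>insert ?s ?I. lborel)"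
       "q k \<in> borel_measurable (\<Pi>\<^sub>M i\<in>insert ?s ?I. lborel)" if "k \<in> {1..?k}" for k
      using meas[OF that Suc.prems(1)] unfolding sets(2) by blast+
    have \<phi>_meas: "\<phi> ?k \<in> measurable (\<Pi>\<^sub>M i\<in>insert ?s ?I. lborel) (\<Pi>\<^sub>M i\<in>insert ?k {1..m}. lborel)"
      unfolding \<phi>_def [abs_def] sets(1) [symmetric]
    proof (rule measurable_restrict)
      fix k assume k: "k \<in> {1..?k}"
      show "(\<lambda>x. moeb (p k x) (q k x) (x (\<sigma> k))) \<in> measurable (\<Pi>\<^sub>M i\<in>insert ?s ?I. lborel) lborel"
        unfolding measurable_lborel1 by (rule borel_measurable_moeb[OF pq_meas[OF k] s_meas[OF k]])
    qed
    have \<delta>_meas: "\<delta> ?k \<in> borel_measurable (\<Pi>\<^sub>M i\<in>insert ?s ?I. lborel)"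
      unfolding \<delta>_def [abs_def]
      by (intro borel_measurable_prod borel_measurable_moeb s_meas pq_meas)
    have F: "F \<in> borel_measurable (\<Pi>\<^sub>M i\<in>insert ?k {1..m}. lborel)"
      using Suc.prems(2) unfolding sets(1) .
    define G where "G x = (\<integral>\<^sup>+t. F (x(?k := t)) * indicator {0..1} t \<partial>lborel)" for x
    have "(\<lambda>z. F ((\<lambda>(f, y). f(?k := y)) z) * indicator {0..1} (snd z))
        \<in> borel_measurable ((\<Pi>\<^sub>M i\<in>{1..m}. lborel) \<Otimes>\<^sub>M lborel)"
      by (rule borel_measurable_times_ennreal[OF measurable_compose[OF measurable_add_dim F]
            measurable_compose[OF measurable_snd]]) simp
    then have G_meas: "G \<in> borel_measurable (\<Pi>\<^sub>M i\<in>{1..m}. lborel)"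
      unfolding G_def [abs_def] by (intro lborel.borel_measurable_nn_integral) (simp add: case_prod_unfold)
    have FI: "(\<lambda>y. F y * indicator (Pi (insert ?k {1..m}) (\<lambda>_. {0..1})) y)
        \<in> borel_measurable (\<Pi>\<^sub>M i\<in>insert ?k {1..m}. lborel)"
      by (rule borel_measurable_times_ennreal[OF F borel_measurable_indicator_Pi]) simp_all
    have FI': "(\<lambda>x. F (\<phi> ?k x) * ennreal (\<delta> ?k x) * indicator (Pi (insert ?s ?I) (\<lambda>_. {0<..<1})) x)
        \<in> borel_measurable (\<Pi>\<^sub>M i\<in>insert ?s ?I. lborel)"
      by (rule borel_measurable_times_ennreal[OF borel_measurable_times_ennreal[OF
            measurable_compose[OF \<phi>_meas F] measurable_compose[OF \<delta>_meas measurable_ennreal]]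
            borel_measurable_indicator_Pi]) simp_all
    have "(\<integral>\<^sup>+y. F y * indicator (Pi {1..?k} (\<lambda>_. {0..1})) y \<partial>(\<Pi>\<^sub>M i\<in>{1..?k}. lborel))
      = (\<integral>\<^sup>+y. (\<integral>\<^sup>+t. F (y(?k := t)) * indicator (Pi (insert ?k {1..m}) (\<lambda>_. {0..1})) (y(?k := t)) \<partial>lborel)
          \<partial>(\<Pi>\<^sub>M i\<in>{1..m}. lborel))"
      unfolding sets(1)
      by (rule P.product_nn_integral_insert[OF _ _ FI]) simp_all
    also have "\<dots> = (\<integral>\<^sup>+y. G y * indicator (Pi {1..m} (\<lambda>_. {0..1})) y \<partial>(\<Pi>\<^sub>M i\<in>{1..m}. lborel))"
      unfolding G_def by (intro nn_integral_cong) (simp add: indicator_Pi_insert_upd indicator_def of_bool_def)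
    also have "\<dots> = (\<integral>\<^sup>+x. G (\<phi> m x) * ennreal (\<delta> m x) * indicator (Pi ?I (\<lambda>_. {0<..<1})) x
       \<partial>(\<Pi>\<^sub>M i\<in>?I. lborel))"
      by (rule Suc.IH) (use G_meas Suc.prems(1) in auto)
    also have "\<dots> = (\<integral>\<^sup>+x. (\<integral>\<^sup>+t. F (\<phi> ?k (x(?s := t))) * ennreal (\<delta> ?k (x(?s := t)))
          * indicator (Pi (insert ?s ?I) (\<lambda>_. {0<..<1})) (x(?s := t)) \<partial>lborel) \<partial>(\<Pi>\<^sub>M i\<in>?I. lborel))"
    proof (rule nn_integral_cong)
      fix x :: "nat \<Rightarrow> real" assume "x \<in> space (\<Pi>\<^sub>M i\<in>?I. lborel)"
      show "G (\<phi> m x) * ennreal (\<delta> m x) * indicator (Pi ?I (\<lambda>_. {0<..<1})) x =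
        (\<integral>\<^sup>+t. F (\<phi> ?k (x(?s := t))) * ennreal (\<delta> ?k (x(?s := t)))
          * indicator (Pi (insert ?s ?I) (\<lambda>_. {0<..<1})) (x(?s := t)) \<partial>lborel)"
      \<comment> \<open>Outside the open cube both sides vanish; inside it the weights are positive,
        as the one-dimensional substitution demands.\<close>
      proof (cases "x \<in> Pi ?I (\<lambda>_. {0<..<1})")
        case False
        then show ?thesis unfolding indicator_Pi_insert_upd[OF notin] by simp
      next
        case True
        have \<sigma>_ne: "\<sigma> k \<noteq> ?s" if "k \<in> {1..m}" for k
          using notin imageI[OF that, of \<sigma>] by metis
        \<comment> \<open>By injectivity of \<sigma> the coordinate \<open>?s\<close> is not read by
          any earlier index, so changing it affects none of the weights up to
          \<open>?k\<close>.\<close>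
        have pq: "p k (x(?s := t)) = p k x" "q k (x(?s := t)) = q k x" if "k \<in> {1..?k}" for k t
        proof -
          have "(x(?s := t)) (\<sigma> i) = x (\<sigma> i)" if "i \<in> {1..<k}" for i
            using \<sigma>_ne[of i] that \<open>k \<in> {1..?k}\<close> by simp
          then show "p k (x(?s := t)) = p k x" "q k (x(?s := t)) = q k x"
            using dep[of k "x(?s := t)" x] that Suc.prems(1) by auto
        qed
        have pq_pos: "0 < p k x" "0 < q k x" if "k \<in> {1..?k}" for k
        proof -
          have "x (\<sigma> i) \<in> {0<..<1}" if "i \<in> {1..<k}" for i
            by (rule Pi_mem[OF True imageI]) (use that \<open>k \<in> {1..?k}\<close> in simp)
          then show "0 < p k x" "0 < q k x"
            using pos[of k x] that Suc.prems(1) by auto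
        qed
        have \<phi>: "\<phi> ?k (x(?s := t)) = (\<phi> m x)(?k := moeb (p ?k x) (q ?k x) t)" for t
        proof
          fix j
          consider "j = ?k" | "j \<in> {1..m}" | "j \<notin> {1..?k}" by force
          then show "\<phi> ?k (x(?s := t)) j = ((\<phi> m x)(?k := moeb (p ?k x) (q ?k x) t)) j"
          proof cases
            case 1
            then show ?thesis using pq[of ?k t] by (simp add: \<phi>_def)
          next
            case 2
            then show ?thesis using pq[of j t] \<sigma>_ne[of j] by (simp add: \<phi>_def)
          next
            case 3
            then show ?thesis by (auto simp add: \<phi>_def)
          qed
        qed
        have "(\<Prod>k=1..m. moeb_deriv (p k (x(?s := t))) (q k (x(?s := t))) ((x(?s := t)) (\<sigma> k))) = \<delta> m x" for t
          unfolding \<delta>_def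
        proof (rule prod.cong)
          fix k assume "k \<in> {1..m}"
          then show "moeb_deriv (p k (x(?s := t))) (q k (x(?s := t))) ((x(?s := t)) (\<sigma> k))
            = moeb_deriv (p k x) (q k x) (x (\<sigma> k))"
            using pq[of k t] \<sigma>_ne[of k] by simp
        qed simp
        then have \<delta>: "\<delta> ?k (x(?s := t)) = \<delta> m x * moeb_deriv (p ?k x) (q ?k x) t" for t
          using pq[of ?k t] by (simp add: \<delta>_def)
        have \<delta>_pos: "\<delta> m x \<ge> 0"
          unfolding \<delta>_def by (intro prod_nonneg moeb_deriv_nonneg less_imp_le pq_pos) simp_all
        have d_pos: "moeb_deriv (p ?k x) (q ?k x) t \<ge> 0" for t
          by (intro moeb_deriv_nonneg less_imp_le pq_pos) simp_all
        have \<phi>_space: "\<phi> m x \<in> space (\<Pi>\<^sub>M i\<in>{1..m}. lborel)"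
          unfolding \<phi>_def space_PiM by simp
        have "?k \<notin> {1..m}" by simp
        from measurable_compose[OF measurable_component_update[OF \<phi>_space this] F]
        have F_meas: "(\<lambda>t. F ((\<phi> m x)(?k := t))) \<in> borel_measurable borel"
          unfolding measurable_lborel2 .
        have F_moeb: "(\<lambda>t. F ((\<phi> m x)(?k := moeb (p ?k x) (q ?k x) t))) \<in> borel_measurable borel"
          by (rule measurable_compose[OF borel_measurable_moeb(1) F_meas]) simp_all
        \<comment> \<open>The substitution is made in the last variable with all others frozen; the
          Jacobian factor \<open>\<delta> m x\<close> is then a constant that can be moved under the
          integral.\<close>
        have "G (\<phi> m x) = (\<integral>\<^sup>+t. F ((\<phi> m x)(?k := moeb (p ?k x) (q ?k x) t))
            * ennreal (moeb_deriv (p ?k x) (q ?k x) t) * indicator {0<..<1} t \<partial>lborel)"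
          unfolding G_def by (rule nn_integral_moeb[OF F_meas pq_pos]) simp_all
        then have "G (\<phi> m x) * ennreal (\<delta> m x) = (\<integral>\<^sup>+t. F ((\<phi> m x)(?k := moeb (p ?k x) (q ?k x) t))
            * ennreal (moeb_deriv (p ?k x) (q ?k x) t) * indicator {0<..<1} t * ennreal (\<delta> m x) \<partial>lborel)"
          using F_moeb by (subst nn_integral_multc) simp_all
        also have "\<dots> = (\<integral>\<^sup>+t. F (\<phi> ?k (x(?s := t))) * ennreal (\<delta> ?k (x(?s := t)))
          * indicator (Pi (insert ?s ?I) (\<lambda>_. {0<..<1})) (x(?s := t)) \<partial>lborel)"
          unfolding indicator_Pi_insert_upd[OF notin] if_P[OF True]
          by (intro nn_integral_cong) (simp add: \<phi> \<delta> ennreal_mult \<delta>_pos d_pos mult_ac)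
        finally show ?thesis by (simp only: indicator_simps(1)[OF True] mult_1_right)
      qed
    qed
    also have "\<dots> = (\<integral>\<^sup>+x. F (\<phi> ?k x) * ennreal (\<delta> ?k x) * indicator (Pi (\<sigma> ` {1..?k}) (\<lambda>_. {0<..<1})) x
       \<partial>(\<Pi>\<^sub>M i\<in>\<sigma> ` {1..?k}. lborel))"
      unfolding sets(2)
      by (rule P.product_nn_integral_insert[OF _ notin FI', symmetric]) simp
    finally show ?case .
  qed
  from this[of n F] show ?thesis
    using assms(5) by (simp add: \<phi>_def \<delta>_def)
qed

section \<open>The polynomials D_k: recursion, dependence and positivity\<close>

lemma D_0 [simp]: "D n 0 x = 1"
  by (simp add: D_def)

lemma D_Suc: "D n (Suc k) x = D n k x + (-1) ^ Suc k * (\<Prod>i=n-k..n. x i)"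
  by (simp add: D_def)

lemma prod_top_Suc:
  fixes x :: "nat \<Rightarrow> real"
  assumes "k < n"
  shows "(\<Prod>i=n-k..n. x i) = x (n - k) * (\<Prod>i=Suc n-k..n. x i)"
  using assms by (simp add: prod.atLeast_Suc_atMost Suc_diff_le)

lemma D_1: "D n (Suc 0) x = 1 - x n"
  by (simp add: D_Suc)

text \<open>Consecutive terms of the alternating sum differ by the factor
  \<open>- x (n - Suc k)\<close>. Hence D_(k+2) - D_(k+1) is this factor times D_(k+1) -
  D_k.\<close>

lemma D_rec:
  assumes "Suc k < n"
  shows "D n (Suc (Suc k)) x = (1 - x (n - Suc k)) * D n (Suc k) x + x (n - Suc k) * D n k x"
  using prod_top_Suc[OF assms, of x] by (simp add: D_Suc[of n "Suc k"] D_Suc[of n k] algebra_simps)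

text \<open>Only the last \<open>k\<close> coordinates, z_1 to z_k, occur in D_k. This makes the
  substitution triangular.\<close>

lemma D_cong:
  assumes "\<And>i. i \<in> {1..k} \<Longrightarrow> x (n + 1 - i) = y (n + 1 - i)" "k \<le> n"
  shows "D n k x = D n k y"
proof -
  have "x i = y i" if "i \<in> {n + 1 - k..n}" for i
  proof -
    have "n + 1 - (n + 1 - i) = i" "n + 1 - i \<in> {1..k}"
      using assms(2) that by auto
    then show ?thesis using assms(1) by metis
  qed
  then show ?thesis
    unfolding D_def by (intro sum.cong refl arg_cong2[where f = "(*)"] prod.cong) auto
qed

text \<open>By the recursion each D_k from k = 2 on is a convex combination of its two predecessors,
  starting from D_0 = 1 and D_1 = 1 - x_n.\<close>

lemma D_pos:
  assumes "\<And>i. i \<in> {1..k} \<Longrightarrow> x (n + 1 - i) \<in> {0<..<1}" "k \<le> n"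
  shows "0 < D n k x"
  using assms
proof (induction k rule: less_induct)
  case (less k)
  consider "k = 0" | "k = 1" | j where "k = Suc (Suc j)"
    by (metis One_nat_def not0_implies_Suc)
  then show ?case
  proof cases
    case 2
    then show ?thesis using less.prems(1)[of 1] by (simp add: D_1)
  next
    case 3
    have "0 < D n j x" "0 < D n (Suc j) x"
      using less 3 by auto
    moreover have "x (n - Suc j) \<in> {0<..<1}"
      using less.prems(1)[of k] 3 by simp
    ultimately show ?thesis
      using less.prems(2) 3 by (auto simp: D_rec intro!: add_pos_pos)
  qed simp
qed

lemma borel_measurable_D:
  assumes "{n + 1 - k..n} \<subseteq> I"
  shows "D n k \<in> borel_measurable (\<Pi>\<^sub>M i\<in>I. lborel)"
proof -
  have [measurable]: "(\<lambda>x. x i) \<in> borel_measurable (\<Pi>\<^sub>M i\<in>I. lborel)" if "i \<in> {n + 1 - j..n}" "j \<in> {0..k}" for i j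
    using measurable_component_singleton[of i I "\<lambda>_. lborel"] that assms by (auto simp: subset_iff)
  show ?thesis
    unfolding D_def [abs_def]
    by (intro borel_measurable_sum borel_measurable_times borel_measurable_prod borel_measurable_const) measurable
qed

section \<open>Balance of exponents, null boundary, and products as exponentials\<close>

lemma powi_eq_exp:
  fixes x :: real
  assumes "0 < x"
  shows "x powi k = exp (of_int k * ln x)"
  using assms powr_real_of_int'[of x k] by (simp add: powr_def)

text \<open>The terms in \<open>\<gamma>\<close> telescope by Abel summation, and the remaining terms cancel in consecutive pairs.\<close>

lemma exponent_identity:
  fixes d \<alpha> \<beta> \<gamma> C :: "nat \<Rightarrow> real"
  assumes "d 0 = 0"
    and even_C: "\<And>k. k \<in> {2..n} \<Longrightarrow> even k \<Longrightarrow> C k = \<alpha> k + \<beta> k - (\<Sum>i=k..n. \<gamma> i)"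
    and odd_C: "\<And>k. k \<in> {3..n} \<Longrightarrow> odd k \<Longrightarrow> C k = (\<Sum>i=k..n. \<gamma> i) - \<alpha> (Suc k)"
    and "2 \<le> m" "m \<le> n"
  shows "(\<alpha> 2 - (\<Sum>i=2..n. \<gamma> i)) * d 1
    + (\<Sum>k=2..m. if even k
        then \<alpha> k * (d (k - 2) - d k) + \<beta> k * (d (k - 1) - d k) - (C k + 1) * (d (k - 1) - d k)
          + d (k - 1) + d (k - 2) - 2 * d k
        else - (C k + 1) * (d k - d (k - 1)))
    = (\<Sum>k\<in>{k\<in>{2..m-2}. even k}. d k) - (\<Sum>k\<in>{k\<in>{3..m-1}. odd k}. d k) - d m
      - (\<Sum>k=2..m. \<gamma> k * d k) - (\<Sum>i=Suc m..n. \<gamma> i) * d m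
      + (if odd m then \<alpha> (Suc m) * (d m - d (m - 1)) else 0)"
  using assms(4,5)
proof (induction m rule: nat_induct_at_least)
  case base
  have "(\<Sum>i=2..n. \<gamma> i) = \<gamma> 2 + (\<Sum>i=3..n. \<gamma> i)"
    using base by (subst sum.atLeast_Suc_atMost) (auto simp: eval_nat_numeral)
  then have C: "C 2 = \<alpha> 2 + \<beta> 2 - (\<gamma> 2 + (\<Sum>i=3..n. \<gamma> i))"
    using even_C[of 2] base by simp
  \<comment> \<open>The first even index leaves \<open>\<alpha> 2 * (d 0 - d 1)\<close>, which the
    prefactor of \<open>d 1\<close> cancels because \<open>d 0 = 0\<close>.\<close>
  show ?case
    by (simp add: C \<open>(\<Sum>i=2..n. \<gamma> i) = _\<close> assms(1) algebra_simps)
next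
  case (Suc m)
  \<comment> \<open>\<open>V\<close> isolates the terms free of parameters; at \<open>m = n\<close>
    they are the logarithm of the quotient of D's multiplied by 1 / D_n.\<close>
  define V where "V m = (\<Sum>k\<in>{k\<in>{2..m-2}. even k}. d k) - (\<Sum>k\<in>{k\<in>{3..m-1}. odd k}. d k) - d m" for m
  have S: "(\<Sum>i=Suc m..n. \<gamma> i) = \<gamma> (Suc m) + (\<Sum>i=Suc (Suc m)..n. \<gamma> i)"
    using Suc.prems by (simp add: sum.atLeast_Suc_atMost)
  show ?case
  \<comment> \<open>Passing to an odd index creates the pending term
    \<open>\<alpha> (Suc m) * (d m - d (m - 1))\<close> of the conclusion; the next even index
    produces its negative.\<close>
  proof (cases "even m")
    case True
    have "{k\<in>{2..Suc m-2}. even k} = {k\<in>{2..m-2}. even k}"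
      unfolding atLeastAtMost_iff using True Suc.hyps by (intro Collect_cong) presburger
    moreover have "{k\<in>{3..Suc m-1}. odd k} = {k\<in>{3..m-1}. odd k}"
      unfolding atLeastAtMost_iff using True Suc.hyps by (intro Collect_cong) presburger
    ultimately have V: "V (Suc m) = V m + d m - d (Suc m)"
      by (simp add: V_def)
    have C: "C (Suc m) = \<gamma> (Suc m) + (\<Sum>i=Suc (Suc m)..n. \<gamma> i) - \<alpha> (Suc (Suc m))"
      using odd_C[of "Suc m"] True Suc S by auto
    show ?thesis
      using Suc.IH Suc.prems Suc.hyps True V unfolding V_def [symmetric]
      by (simp add: C S algebra_simps)
  next
    case False
    then have m: "m \<ge> 3" using Suc.hyps by (cases "m = 2") auto
    have "{k\<in>{2..Suc m-2}. even k} = insert (m - 1) {k\<in>{2..m-2}. even k}"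
      unfolding atLeastAtMost_iff insert_Collect using False m by (intro Collect_cong) presburger
    moreover have "{k\<in>{3..Suc m-1}. odd k} = insert m {k\<in>{3..m-1}. odd k}"
      unfolding atLeastAtMost_iff insert_Collect using False m by (intro Collect_cong) presburger
    moreover have "m - 1 \<notin> {k\<in>{2..m-2}. even k}" "m \<notin> {k\<in>{3..m-1}. odd k}"
      using m by auto
    ultimately have V: "V (Suc m) = V m + d (m - 1) - d (Suc m)"
      by (simp add: V_def)
    have C: "C (Suc m) = \<alpha> (Suc m) + \<beta> (Suc m) - \<gamma> (Suc m) - (\<Sum>i=Suc (Suc m)..n. \<gamma> i)"
      using even_C[of "Suc m"] False Suc S by auto
    have "Suc m - 2 = m - 1" by simp
    then show ?thesis
      using Suc.IH Suc.prems Suc.hyps False V unfolding V_def [symmetric]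
      by (simp add: C S algebra_simps)
  qed
qed

text \<open>With weights \<open>p = q = 1\<close> the transformation is the identity and only the null boundary is dropped.\<close>

lemma nn_integral_closed_open_cube:
  assumes "F \<in> borel_measurable (\<Pi>\<^sub>M i\<in>{1..n}. lborel)"
  shows "(\<integral>\<^sup>+x. F x * indicator (Pi {1..n} (\<lambda>_. {0..1})) x \<partial>(\<Pi>\<^sub>M i\<in>{1..n::nat}. lborel)) =
    (\<integral>\<^sup>+x. F x * indicator (Pi {1..n} (\<lambda>_. {0<..<1})) x \<partial>(\<Pi>\<^sub>M i\<in>{1..n}. (lborel :: real measure)))"
proof -
  have "(\<integral>\<^sup>+x. F x * indicator (Pi {1..n} (\<lambda>_. {0..1})) x \<partial>(\<Pi>\<^sub>M i\<in>{1..n}. lborel)) =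
    (\<integral>\<^sup>+x. F (\<lambda>k\<in>{1..n}. moeb 1 1 (x (id k))) * ennreal (\<Prod>k=1..n. moeb_deriv 1 1 (x (id k)))
        * indicator (Pi (id ` {1..n}) (\<lambda>_. {0<..<1})) x \<partial>(\<Pi>\<^sub>M i\<in>id ` {1..n}. lborel))"
    by (rule nn_integral_triangular_moeb[where p = "\<lambda>_ _. 1" and q = "\<lambda>_ _. 1"]) (use assms in auto)
  also have "\<dots> = (\<integral>\<^sup>+x. F x * indicator (Pi {1..n} (\<lambda>_. {0<..<1})) x \<partial>(\<Pi>\<^sub>M i\<in>{1..n}. lborel))"
    unfolding image_id id_apply
    by (intro nn_integral_cong)
      (simp add: moeb_def moeb_deriv_def space_PiM PiE_def extensional_restrict)
  finally show ?thesis .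
qed

text \<open>The cube is extensional, whereas the substitution results use \<open>Pi\<close>; on the
  space of the product measure the two conditions agree.\<close>

lemma nn_integral_cube:
  "(\<integral>\<^sup>+x \<in> cube n. F x \<partial>lebesgue_n n)
    = (\<integral>\<^sup>+x. F x * indicator (Pi {1..n} (\<lambda>_. {0..1})) x \<partial>(\<Pi>\<^sub>M i\<in>{1..n}. lborel))"
proof -
  have "indicator (cube n) x = (indicator (Pi {1..n} (\<lambda>_. {0..1})) x :: ennreal)"
    if "x \<in> space (\<Pi>\<^sub>M i\<in>{1..n}. (lborel :: real measure))" for x
    using that by (simp add: cube_def space_PiM PiE_def indicator_def)
  then show ?thesis
    unfolding lebesgue_n_def by (intro nn_integral_cong) simp
qed

text \<open>This reduces an identity between products of positive factors to a linear identity
  between logarithms. For infinite \<open>S\<close> both sides are 1 by convention.\<close>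

lemma prod_powi_eq_exp:
  fixes f :: "'a \<Rightarrow> real"
  assumes "\<And>k. k \<in> S \<Longrightarrow> 0 < f k"
  shows "(\<Prod>k\<in>S. f k powi m k) = exp (\<Sum>k\<in>S. of_int (m k) * ln (f k))"
proof (cases "finite S")
  case True
  have "(\<Prod>k\<in>S. f k powi m k) = (\<Prod>k\<in>S. exp (of_int (m k) * ln (f k)))"
    using assms by (intro prod.cong) (auto simp: powi_eq_exp)
  then show ?thesis by (simp add: exp_sum[OF True])
qed simp

lemma prod_eq_exp:
  fixes f :: "'a \<Rightarrow> real"
  assumes "\<And>k. k \<in> S \<Longrightarrow> 0 < f k"
  shows "(\<Prod>k\<in>S. f k) = exp (\<Sum>k\<in>S. ln (f k))"
  using prod_powi_eq_exp[of S f "\<lambda>_. 1"] assms by simp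

section \<open>The concrete substitution and its Jacobian\<close>

text \<open>The weight 1 at odd indices makes the Moebius map the identity there, so one formula
  serves both parities.\<close>

definition weight_p :: "nat \<Rightarrow> nat \<Rightarrow> (nat \<Rightarrow> real) \<Rightarrow> real" where
  "weight_p n k x = (if even k then D n (k - 1) x else 1)"

definition weight_q :: "nat \<Rightarrow> nat \<Rightarrow> (nat \<Rightarrow> real) \<Rightarrow> real" where
  "weight_q n k x = (if even k then D n (k - 2) x else 1)"

definition subst_y :: "nat \<Rightarrow> (nat \<Rightarrow> real) \<Rightarrow> nat \<Rightarrow> real" where
  "subst_y n x k = moeb (weight_p n k x) (weight_q n k x) (x (n + 1 - k))"

definition subst_jac :: "nat \<Rightarrow> (nat \<Rightarrow> real) \<Rightarrow> nat \<Rightarrow> real" where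
  "subst_jac n x k = moeb_deriv (weight_p n k x) (weight_q n k x) (x (n + 1 - k))"

text \<open>For even \<open>k\<close> this is the recursion for D, and it is where the denominators
  D_k of the substitution come from.\<close>

lemma weight_denominator:
  assumes "k \<in> {1..n}"
  shows "(1 - x (n + 1 - k)) * weight_p n k x + x (n + 1 - k) * weight_q n k x
    = (if even k then D n k x else 1)"
proof (cases "even k")
  case True
  then obtain j where "k = Suc (Suc j)"
    using assms by (metis One_nat_def atLeastAtMost_iff not0_implies_Suc not_one_le_zero odd_one)
  then show ?thesis
    using assms True by (simp add: weight_p_def weight_q_def D_rec)
qed (simp add: weight_p_def weight_q_def)

lemma subst_y_even:
  assumes "k \<in> {1..n}" "even k"
  shows "subst_y n x k = x (n + 1 - k) * D n (k - 2) x / D n k x"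
    and "subst_jac n x k = D n (k - 1) x * D n (k - 2) x / (D n k x)\<^sup>2"
  using assms weight_denominator[OF assms(1), of x]
  by (simp_all add: subst_y_def subst_jac_def moeb_def moeb_deriv_def weight_q_def weight_p_def)

lemma one_minus_subst_y_even:
  assumes "k \<in> {1..n}" "even k" "D n k x \<noteq> 0"
  shows "1 - subst_y n x k = (1 - x (n + 1 - k)) * D n (k - 1) x / D n k x"
proof -
  have "D n k x = (1 - x (n + 1 - k)) * D n (k - 1) x + x (n + 1 - k) * D n (k - 2) x"
    using weight_denominator[OF assms(1), of x] assms(2) by (simp add: weight_q_def weight_p_def)
  then show ?thesis
    unfolding subst_y_even(1)[OF assms(1,2)] using assms(3) by (simp add: diff_divide_eq_iff)
qed

lemma subst_y_odd:
  assumes "odd k"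
  shows "subst_y n x k = x (n + 1 - k)" "subst_jac n x k = 1"
  using assms by (simp_all add: subst_y_def subst_jac_def moeb_def moeb_deriv_def weight_q_def weight_p_def)

text \<open>Each even index contributes the extra factor D_(k-2) / D_k and each odd index none. The
  factors telescope, leaving D at the largest even index not exceeding \<open>k\<close>.\<close>

lemma prod_subst_y:
  assumes "\<And>j. j \<le> n \<Longrightarrow> D n j x \<noteq> 0" "k \<le> n"
  shows "(\<Prod>i=1..k. subst_y n x i) = (\<Prod>i=n+1-k..n. x i) / D n (if even k then k else k - 1) x"
  using assms(2)
proof (induction k)
  case (Suc k)
  have x: "(\<Prod>i=n-k..n. x i) = x (n - k) * (\<Prod>i=Suc n-k..n. x i)"
    using Suc.prems by (intro prod_top_Suc) simp
  show ?case
  proof (cases "even k")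
    case True
    then show ?thesis
      using Suc x by (simp add: subst_y_odd)
  next
    case False
    then have "subst_y n x (Suc k) = x (n - k) * D n (k - 1) x / D n (Suc k) x"
      using Suc.prems subst_y_even(1)[of "Suc k" n x] by simp
    then show ?thesis
      using Suc x False assms(1)[of "k - 1"] by simp
  qed
qed simp

text \<open>Let Z be the product z_1 ... z_k. Then D_k = D_(k-1) + (-1)^k Z, while the product of
  the \<open>subst_y\<close> is Z / D_k for even \<open>k\<close> and Z / D_(k-1) for odd
  \<open>k\<close>; subtracting from 1 leaves a ratio of neighbouring D's.\<close>

lemma one_minus_prod_subst_y:
  assumes "\<And>j. j \<le> n \<Longrightarrow> D n j x \<noteq> 0" "k \<in> {1..n}"
  shows "1 - (\<Prod>i=1..k. subst_y n x i) =
    (if even k then D n (k - 1) x / D n k x else D n k x / D n (k - 1) x)"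
proof -
  define j where "j = k - 1"
  have k: "k = Suc j"
    using assms(2) by (simp add: j_def)
  have "D n k x = D n j x + (-1) ^ k * (\<Prod>i=n-j..n. x i)"
    unfolding k by (rule D_Suc)
  moreover have "(\<Prod>i=1..k. subst_y n x i) = (\<Prod>i=n-j..n. x i) / D n (if even k then k else j) x"
    using prod_subst_y[of n x k] assms unfolding j_def by simp
  moreover have "D n k x \<noteq> 0" "D n j x \<noteq> 0"
    using assms k by auto
  ultimately show ?thesis
    unfolding j_def [symmetric] by (cases "even k") (simp_all add: field_simps)
qed

section \<open>Pointwise comparison of the integrands\<close>

text \<open>On the open cube every factor is positive, so both sides are exponentials of linear
  combinations of logarithms. Those of x_k and 1 - x_k match after reversing the index; those of the
  D_k match by \<open>exponent_identity\<close>.\<close>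

lemma integrand_identity:
  fixes n :: nat and a b c A B C :: "nat \<Rightarrow> int"
  assumes n: "n \<ge> 2"
    and A: "\<And>k. k \<in> {1..n} \<Longrightarrow> A k = a (n + 1 - k)"
    and B: "\<And>k. k \<in> {2..n} \<Longrightarrow> B k = b (n + 1 - k)"
    and B1: "B 1 = a (n - 1) + b n - (\<Sum>i=2..n. c i)"
    and C_even: "\<And>k. k \<in> {2..n} \<Longrightarrow> even k \<Longrightarrow>
           C k = a (n + 1 - k) + b (n + 1 - k) - (\<Sum>i=k..n. c i)"
    and C_odd: "\<And>k. k \<in> {3..n} \<Longrightarrow> odd k \<Longrightarrow>
           C k = (\<Sum>i=k..n. c i) - (if k = n then 0 else a (n - k))"
    and x: "\<And>i. i \<in> {1..n} \<Longrightarrow> x i \<in> {0<..<1}"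
  defines "y \<equiv> subst_y n x"
  shows "(\<Prod>k=1..n. y k powi A k * (1 - y k) powi B k)
      / (\<Prod>k=2..n. (1 - (\<Prod>i=1..k. y i)) powi (C k + 1)) * (\<Prod>k=1..n. subst_jac n x k)
    = (\<Prod>k=1..n. x k powi a k * (1 - x k) powi b k) / (\<Prod>k=2..n. D n k x powi c k)
      * ((\<Prod>k\<in>{k\<in>{2..n-2}. even k}. D n k x) / (\<Prod>k\<in>{k\<in>{3..n-1}. odd k}. D n k x))
      * (1 / D n n x)" (is "?K = ?J")
proof -
  have D_gt0: "0 < D n k x" if "k \<le> n" for k
    using that by (intro D_pos x) auto
  then have D_ne: "D n k x \<noteq> 0" if "k \<le> n" for k
    using that by (simp add: less_imp_neq[symmetric])
  have x_rev: "0 < x (n + 1 - k)" "0 < 1 - x (n + 1 - k)" if "k \<in> {1..n}" for k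
  proof -
    have "n + 1 - k \<in> {1..n}"
      using that unfolding atLeastAtMost_iff by arith
    from x[OF this] show "0 < x (n + 1 - k)" "0 < 1 - x (n + 1 - k)"
      by simp_all
  qed
  \<comment> \<open>All logarithms are expressed through \<open>d\<close>, \<open>u\<close> and
    \<open>v\<close>, where \<open>u k\<close> and \<open>v k\<close> belong to z_k and 1 -
    z_k.\<close>
  define d where "d k = ln (D n k x)" for k
  define u where "u k = ln (x (n + 1 - k))" for k
  define v where "v k = ln (1 - x (n + 1 - k))" for k
  define e where "e k = (if even k then d (k - 1) - d k else d k - d (k - 1))" for k
  have y: "0 < y k" "ln (y k) = u k + (if even k then d (k - 2) - d k else 0)"
    and y1: "0 < 1 - y k" "ln (1 - y k) = v k + (if even k then d (k - 1) - d k else 0)"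
    and jac: "0 < subst_jac n x k"
      "ln (subst_jac n x k) = (if even k then d (k - 1) + d (k - 2) - 2 * d k else 0)"
    if k: "k \<in> {1..n}" for k
  proof -
    have pos: "0 < D n k x" "0 < D n (k - 1) x" "0 < D n (k - 2) x"
      using k by (auto intro!: D_gt0)
    note xk = x_rev[OF k]
    show "0 < y k" "ln (y k) = u k + (if even k then d (k - 2) - d k else 0)"
      using k xk pos unfolding y_def
      by (cases "even k"; simp add: subst_y_even subst_y_odd u_def d_def ln_mult ln_div)+
    show "0 < subst_jac n x k"
      "ln (subst_jac n x k) = (if even k then d (k - 1) + d (k - 2) - 2 * d k else 0)"
      using k xk pos
      by (cases "even k"; simp add: subst_y_even subst_y_odd u_def d_def ln_mult ln_div ln_realpow)+
    show "0 < 1 - y k" "ln (1 - y k) = v k + (if even k then d (k - 1) - d k else 0)"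
      using k xk pos unfolding y_def
      by (cases "even k"; simp add: one_minus_subst_y_even D_ne subst_y_odd v_def d_def ln_mult ln_div
            del: diff_gt_0_iff_gt)+
  qed
  have e: "0 < 1 - (\<Prod>i=1..k. y i)" "ln (1 - (\<Prod>i=1..k. y i)) = e k" if k: "k \<in> {2..n}" for k
  proof -
    have pos: "0 < D n k x" "0 < D n (k - 1) x"
      using k by (auto intro!: D_gt0)
    have eq: "1 - (\<Prod>i=1..k. y i) =
        (if even k then D n (k - 1) x / D n k x else D n k x / D n (k - 1) x)"
      unfolding y_def using k by (intro one_minus_prod_subst_y D_ne) auto
    show "0 < 1 - (\<Prod>i=1..k. y i)" "ln (1 - (\<Prod>i=1..k. y i)) = e k"
      unfolding eq using pos by (simp_all add: e_def d_def ln_div)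
  qed
  define LJ where "LJ = (\<Sum>k=1..n. of_int (a k) * ln (x k)) + (\<Sum>k=1..n. of_int (b k) * ln (1 - x k))
    - (\<Sum>k=2..n. of_int (c k) * d k)
    + ((\<Sum>k\<in>{k\<in>{2..n-2}. even k}. d k) - (\<Sum>k\<in>{k\<in>{3..n-1}. odd k}. d k)) - d n"
  define LK where "LK = (\<Sum>k=1..n. of_int (A k) * ln (y k)) + (\<Sum>k=1..n. of_int (B k) * ln (1 - y k))
    - (\<Sum>k=2..n. of_int (C k + 1) * e k) + (\<Sum>k=1..n. ln (subst_jac n x k))"
  have "(\<Prod>k=1..n. x k powi a k) = exp (\<Sum>k=1..n. of_int (a k) * ln (x k))"
    using x by (intro prod_powi_eq_exp) auto
  moreover have "(\<Prod>k=1..n. (1 - x k) powi b k) = exp (\<Sum>k=1..n. of_int (b k) * ln (1 - x k))"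
    using x by (intro prod_powi_eq_exp) auto
  moreover have "(\<Prod>k=2..n. D n k x powi c k) = exp (\<Sum>k=2..n. of_int (c k) * d k)"
    unfolding d_def using D_gt0 by (intro prod_powi_eq_exp) auto
  moreover have "(\<Prod>k\<in>{k\<in>{2..n-2}. even k}. D n k x) = exp (\<Sum>k\<in>{k\<in>{2..n-2}. even k}. d k)"
    "(\<Prod>k\<in>{k\<in>{3..n-1}. odd k}. D n k x) = exp (\<Sum>k\<in>{k\<in>{3..n-1}. odd k}. d k)"
    unfolding d_def using D_gt0 by (intro prod_eq_exp; auto)+
  moreover have "D n n x = exp (d n)"
    unfolding d_def using D_gt0 by simp
  ultimately have J: "?J = exp LJ"
    unfolding LJ_def by (simp add: prod.distrib exp_add exp_diff)
  have "(\<Prod>k=1..n. y k powi A k) = exp (\<Sum>k=1..n. of_int (A k) * ln (y k))"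
    using y by (intro prod_powi_eq_exp) auto
  moreover have "(\<Prod>k=1..n. (1 - y k) powi B k) = exp (\<Sum>k=1..n. of_int (B k) * ln (1 - y k))"
    using y1 by (intro prod_powi_eq_exp) auto
  moreover have "(\<Prod>k=2..n. (1 - (\<Prod>i=1..k. y i)) powi (C k + 1))
      = exp (\<Sum>k=2..n. of_int (C k + 1) * ln (1 - (\<Prod>i=1..k. y i)))"
    using e by (intro prod_powi_eq_exp) auto
  moreover have "(\<Sum>k=2..n. of_int (C k + 1) * ln (1 - (\<Prod>i=1..k. y i))) = (\<Sum>k=2..n. of_int (C k + 1) * e k)"
    using e(2) by (intro sum.cong) auto
  moreover have "(\<Prod>k=1..n. subst_jac n x k) = exp (\<Sum>k=1..n. ln (subst_jac n x k))"
    using jac by (intro prod_eq_exp) auto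
  ultimately have K: "?K = exp LK"
    unfolding LK_def by (simp only: prod.distrib exp_add exp_diff)
  \<comment> \<open>The cut-off gives \<open>\<alpha> (Suc n) = 0\<close>, which encodes the
    convention a_0 = 0.\<close>
  define \<alpha> :: "nat \<Rightarrow> real" where "\<alpha> k = (if k \<le> n then of_int (A k) else 0)" for k
  \<comment> \<open>\<open>t k\<close> is what remains of the k-th summand of \<open>LK\<close> once
    its \<open>u\<close> and \<open>v\<close> terms are removed.\<close>
  define t where "t k = (if even k
        then \<alpha> k * (d (k - 2) - d k) + of_int (B k) * (d (k - 1) - d k) - (of_int (C k) + 1) * (d (k - 1) - d k)
          + d (k - 1) + d (k - 2) - 2 * d k
        else - (of_int (C k) + 1) * (d k - d (k - 1)))" for k
  have split: "(\<Sum>k=1..n. f k) = f 1 + (\<Sum>k=2..n. f k)" for f :: "nat \<Rightarrow> real"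
    using n by (simp add: sum.atLeast_Suc_atMost numeral_2_eq_2)
  have rev: "(\<Sum>k=1..n. f k) = f n + (\<Sum>k=2..n. f (n + 1 - k))" for f :: "nat \<Rightarrow> real"
    by (subst sum.atLeastAtMost_rev, subst split) simp
  \<comment> \<open>Since D_1 = 1 - z_1, the factor with exponent \<open>B 1\<close> is itself a
    power of D_1; this is why \<open>B 1\<close> obeys a different rule from the other
    \<open>B k\<close>.\<close>
  have d1: "v 1 = d 1" "d 0 = 0"
    by (simp_all add: v_def d_def D_1)
  have "LK = of_int (A 1) * u 1 + of_int (B 1) * d 1
      + (\<Sum>k=2..n. of_int (A k) * ln (y k) + of_int (B k) * ln (1 - y k)
          - of_int (C k + 1) * e k + ln (subst_jac n x k))"
    unfolding LK_def split sum.distrib sum_subtractf using n d1 by (simp add: y y1 jac)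
  also have "(\<Sum>k=2..n. of_int (A k) * ln (y k) + of_int (B k) * ln (1 - y k)
          - of_int (C k + 1) * e k + ln (subst_jac n x k))
      = (\<Sum>k=2..n. of_int (A k) * u k + of_int (B k) * v k + t k)"
    by (intro sum.cong) (auto simp: y y1 jac t_def e_def \<alpha>_def algebra_simps)
  also have "\<dots> = (\<Sum>k=2..n. of_int (A k) * u k + of_int (B k) * v k) + (\<Sum>k=2..n. t k)"
    by (rule sum.distrib)
  also have "(\<Sum>k=2..n. of_int (A k) * u k + of_int (B k) * v k)
      = (\<Sum>k=2..n. of_int (a (n + 1 - k)) * u k + of_int (b (n + 1 - k)) * v k)"
    by (intro sum.cong) (auto simp: A B)
  also have "of_int (A 1) * u 1 + of_int (B 1) * d 1
      + ((\<Sum>k=2..n. of_int (a (n + 1 - k)) * u k + of_int (b (n + 1 - k)) * v k) + (\<Sum>k=2..n. t k))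
    = (\<Sum>k=1..n. of_int (a k) * ln (x k)) + (\<Sum>k=1..n. of_int (b k) * ln (1 - x k))
      + ((\<alpha> 2 - (\<Sum>i=2..n. of_int (c i))) * d 1 + (\<Sum>k=2..n. t k))"
  proof -
    \<comment> \<open>As \<open>A 2 = a (n - 1)\<close>, the difference between \<open>B 1\<close>
      and \<open>b n\<close> is exactly the coefficient of \<open>d 1\<close> in
      \<open>exponent_identity\<close>.\<close>
    have "\<alpha> 2 = of_int (a (n - 1))"
      using n A[of 2] by (simp add: \<alpha>_def numeral_2_eq_2)
    moreover have "A 1 = a n" "u 1 = ln (x n)" "d 1 = ln (1 - x n)"
      using n A[of 1] d1 by (simp_all add: u_def v_def)
    ultimately show ?thesis
      unfolding rev B1 by (simp add: u_def v_def sum.distrib algebra_simps)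
  qed
  also have "(\<alpha> 2 - (\<Sum>i=2..n. of_int (c i))) * d 1 + (\<Sum>k=2..n. t k)
    = (\<Sum>k\<in>{k\<in>{2..n-2}. even k}. d k) - (\<Sum>k\<in>{k\<in>{3..n-1}. odd k}. d k) - d n
      - (\<Sum>k=2..n. of_int (c k) * d k) - (\<Sum>i=Suc n..n. of_int (c i)) * d n
      + (if odd n then \<alpha> (Suc n) * (d n - d (n - 1)) else 0)"
    unfolding t_def
  proof (rule exponent_identity)
    fix k assume "k \<in> {2..n}" "even k"
    then show "real_of_int (C k) = \<alpha> k + of_int (B k) - (\<Sum>i=k..n. of_int (c i))"
      using C_even[of k] A[of k] B[of k] by (simp add: \<alpha>_def)
  next
    fix k assume k: "k \<in> {3..n}" "odd k"
    \<comment> \<open>Index reversal: n + 1 - (k + 1) = n - k, so a_(n-k) is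
      \<open>A (Suc k)\<close> for k < n.\<close>
    have "(if k = n then 0 else a (n - k)) = (if Suc k \<le> n then A (Suc k) else 0)"
      using A[of "Suc k"] k by auto
    then show "real_of_int (C k) = (\<Sum>i=k..n. of_int (c i)) - \<alpha> (Suc k)"
      using C_odd[OF k] by (auto simp: \<alpha>_def)
  qed (use n d1 in auto)
  \<comment> \<open>The identity was used at \<open>m = n\<close>, where the tail sum over
    \<open>c\<close> is empty and the pending term vanishes by
    \<open>\<alpha> (Suc n) = 0\<close>.\<close>
  finally have "LK = LJ"
    by (simp add: LJ_def \<alpha>_def)
  then show ?thesis by (simp only: J K)
qed

section \<open>Assembling the equality of the integrals\<close>

text \<open>The weights at \<open>k\<close> involve D of index at most \<open>k - 1\<close>, so they
  read only z_1 to z_(k-1).\<close>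

lemma weight_pos:
  assumes "k \<in> {1..n}" "\<And>i. i \<in> {1..<k} \<Longrightarrow> x (n + 1 - i) \<in> {0<..<1}"
  shows "0 < weight_p n k x \<and> 0 < weight_q n k x"
proof -
  have "0 < D n j x" if "j < k" for j
    using that assms(1) by (intro D_pos assms(2)) auto
  then show ?thesis
    using assms(1) by (simp add: weight_p_def weight_q_def)
qed

theorem mainTheorem1:
  fixes n :: nat and a b c A B C :: "nat \<Rightarrow> int"
  assumes "n \<ge> 2"
    and "\<And>k. k \<in> {1..n} \<Longrightarrow> A k = a (n + 1 - k)"
    and "\<And>k. k \<in> {2..n} \<Longrightarrow> B k = b (n + 1 - k)"
    and "B 1 = a (n - 1) + b n - (\<Sum>i=2..n. c i)"
    and "\<And>k. k \<in> {2..n} \<Longrightarrow> even k \<Longrightarrow>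
           C k = a (n + 1 - k) + b (n + 1 - k) - (\<Sum>i=k..n. c i)"
    and "\<And>k. k \<in> {3..n} \<Longrightarrow> odd k \<Longrightarrow>
           C k = (\<Sum>i=k..n. c i) - (if k = n then 0 else a (n - k))"
  shows "J n a b c = K n A B C"
proof -
  define JF where "JF x = (\<Prod>k=1..n. x k powi a k * (1 - x k) powi b k) / (\<Prod>k=2..n. D n k x powi c k)
      * ((\<Prod>k\<in>{k\<in>{2..n-2}. even k}. D n k x) / (\<Prod>k\<in>{k\<in>{3..n-1}. odd k}. D n k x))
      * (1 / D n n x)" for x
  define KF where "KF y = (\<Prod>k=1..n. y k powi A k * (1 - y k) powi B k)
      / (\<Prod>k=2..n. (1 - (\<Prod>i=1..k. y i)) powi (C k + 1))" for y :: "nat \<Rightarrow> real"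
  let ?M = "\<Pi>\<^sub>M i\<in>{1..n}. (lborel :: real measure)"
  let ?open = "indicator (Pi {1..n} (\<lambda>_. {0<..<1})) :: (nat \<Rightarrow> real) \<Rightarrow> ennreal"
  let ?\<sigma> = "\<lambda>k. n + 1 - k"
  have comp: "(\<lambda>x. x k) \<in> borel_measurable ?M" if "k \<in> {1..n}" for k
    using measurable_component_singleton[OF that, of "\<lambda>_. lborel"] unfolding measurable_lborel1 .
  have D_meas: "(\<lambda>x. D n k x) \<in> borel_measurable ?M" if "k \<le> n" for k
    using that by (intro borel_measurable_D) auto
  have JF_meas: "JF \<in> borel_measurable ?M"
    unfolding JF_def [abs_def]
    by (intro borel_measurable_times borel_measurable_divide borel_measurable_prod borel_measurable_powi
          borel_measurable_diff borel_measurable_const comp D_meas) auto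
  have KF_meas: "KF \<in> borel_measurable ?M"
    unfolding KF_def [abs_def]
    by (intro borel_measurable_times borel_measurable_divide borel_measurable_prod borel_measurable_powi
          borel_measurable_diff borel_measurable_const comp) auto
  have \<sigma>_image: "?\<sigma> ` {1..n} = {1..n}"
  proof
    show "{1..n} \<subseteq> ?\<sigma> ` {1..n}"
    proof
      fix i assume "i \<in> {1..n}"
      then have "i = ?\<sigma> (?\<sigma> i)" "?\<sigma> i \<in> {1..n}" by auto
      then show "i \<in> ?\<sigma> ` {1..n}" by (rule image_eqI)
    qed
  qed auto
  have "J n a b c = (\<integral>\<^sup>+x. ennreal (JF x) * indicator (Pi {1..n} (\<lambda>_. {0..1})) x \<partial>?M)"
    unfolding J_def JF_def [symmetric] by (rule nn_integral_cube)
  also have "\<dots> = (\<integral>\<^sup>+x. ennreal (JF x) * ?open x \<partial>?M)"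
    by (rule nn_integral_closed_open_cube) (rule measurable_compose[OF JF_meas measurable_ennreal])
  also have "\<dots> = (\<integral>\<^sup>+x. ennreal (KF (\<lambda>k\<in>{1..n}. subst_y n x k))
      * ennreal (\<Prod>k=1..n. subst_jac n x k) * ?open x \<partial>?M)"
  proof (rule nn_integral_cong)
    fix x
    show "ennreal (JF x) * ?open x
      = ennreal (KF (\<lambda>k\<in>{1..n}. subst_y n x k)) * ennreal (\<Prod>k=1..n. subst_jac n x k) * ?open x"
    proof (cases "x \<in> Pi {1..n} (\<lambda>_. {0<..<1})")
      case True
      \<comment> \<open>The triangular substitution produces an extensional point; \<open>KF\<close>
        evaluates it only at indices in \<open>{1..n}\<close>.\<close>
      have "KF (\<lambda>k\<in>{1..n}. subst_y n x k) = KF (subst_y n x)"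
        unfolding KF_def
        by (intro arg_cong2[where f = "(/)"] arg_cong2[where f = "(powi)"] arg_cong2[where f = "(-)"]
            prod.cong refl) auto
      moreover have "KF (subst_y n x) * (\<Prod>k=1..n. subst_jac n x k) = JF x"
        unfolding KF_def JF_def using assms Pi_mem[OF True] by (rule integrand_identity)
      moreover have "0 \<le> (\<Prod>k=1..n. subst_jac n x k)"
        unfolding subst_jac_def
      proof (intro prod_nonneg moeb_deriv_nonneg)
        fix k assume "k \<in> {1..n}"
        then have "0 < weight_p n k x \<and> 0 < weight_q n k x"
          by (intro weight_pos Pi_mem[OF True]) auto
        then show "0 \<le> weight_p n k x" "0 \<le> weight_q n k x" by simp_all
      qed
      ultimately show ?thesis
        by (simp only: ennreal_mult'' [symmetric])
    next
      case False
      then show ?thesis by simp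
    qed
  qed
  also have "\<dots> = (\<integral>\<^sup>+y. ennreal (KF y) * indicator (Pi {1..n} (\<lambda>_. {0..1})) y \<partial>?M)"
    unfolding subst_y_def subst_jac_def
  \<comment> \<open>The substitution is read from right to left. Index reversal permutes
    \<open>{1..n}\<close>, so both integrals live on the same product space.\<close>
  proof (rule nn_integral_triangular_moeb[where n = n and \<sigma> = ?\<sigma>, unfolded \<sigma>_image, symmetric])
    show "inj_on ?\<sigma> {1..n}"
      by (auto simp: inj_on_def)
    show "weight_p n k \<in> borel_measurable (\<Pi>\<^sub>M i\<in>?\<sigma> ` {1..m}. lborel) \<and>
      weight_q n k \<in> borel_measurable (\<Pi>\<^sub>M i\<in>?\<sigma> ` {1..m}. lborel)"
      if "k \<in> {1..m}" "m \<le> n" for k m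
    proof -
      \<comment> \<open>The reversal sends \<open>{1..m}\<close> to the last \<open>m\<close>
        indices, which include every coordinate read by D_j for \<open>j \<le> k\<close>.\<close>
      have "{n + 1 - j..n} \<subseteq> ?\<sigma> ` {1..m}" if "j \<le> k" for j
      proof
        fix i assume "i \<in> {n + 1 - j..n}"
        then have "i = ?\<sigma> (?\<sigma> i)" "?\<sigma> i \<in> {1..m}"
          using \<open>k \<in> {1..m}\<close> \<open>m \<le> n\<close> that by auto
        then show "i \<in> ?\<sigma> ` {1..m}" by (rule image_eqI)
      qed
      then have "D n (k - 1) \<in> borel_measurable (\<Pi>\<^sub>M i\<in>?\<sigma> ` {1..m}. lborel)"
        "D n (k - 2) \<in> borel_measurable (\<Pi>\<^sub>M i\<in>?\<sigma> ` {1..m}. lborel)"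
        by (intro borel_measurable_D; simp)+
      then show ?thesis
        unfolding weight_p_def [abs_def] weight_q_def [abs_def] by (cases "even k") simp_all
    qed
    show "weight_p n k x = weight_p n k y \<and> weight_q n k x = weight_q n k y"
      if "k \<in> {1..n}" "\<And>i. i \<in> {1..<k} \<Longrightarrow> x (?\<sigma> i) = y (?\<sigma> i)" for k x y
    proof -
      have "D n j x = D n j y" if "j < k" for j
        using that \<open>k \<in> {1..n}\<close> by (intro D_cong \<open>\<And>i. i \<in> {1..<k} \<Longrightarrow> x (?\<sigma> i) = y (?\<sigma> i)\<close>) auto
      then show ?thesis
        using \<open>k \<in> {1..n}\<close> by (simp add: weight_p_def weight_q_def)
    qed
    show "0 < weight_p n k x \<and> 0 < weight_q n k x"
      if "k \<in> {1..n}" "\<And>i. i \<in> {1..<k} \<Longrightarrow> x (?\<sigma> i) \<in> {0<..<1}" for k x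
      using that by (rule weight_pos)
    show "(\<lambda>y. ennreal (KF y)) \<in> borel_measurable ?M"
      by (rule measurable_compose[OF KF_meas measurable_ennreal])
  qed
  also have "\<dots> = K n A B C"
    unfolding K_def KF_def [symmetric] by (rule nn_integral_cube [symmetric])
  finally show ?thesis .
qed

end
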